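(* Let $R>0$, let $m,n$ be real constants, and let $\mathbb{A},\mathbb{B},\mathbb{C},\mathbb{D}$ be bounded real-valued functions on $[R,\infty)$. (A) Assume $\mathbb{A}>0$, $\mathbb{D}>0$, $\mathbb{B}\le0$, $\mathbb{C}\le0$ and $4\mathbb{A}\mathbb{D}-(\mathbb{B}+\mathbb{C})^2>0$ in $[R,\infty)$. If $u,v$ are radial functions satisfying $$-\Delta_ru+\frac{m^2}{r^2}u+\mathbb{A}u+\mathbb{B}v\le0,\qquad -\Delta_rv+\frac{n^2}{r^2}v+\mathbb{C}u+\mathbb{D}v\le0\qquad\text{in }[R,\infty),$$ with $u(R)\le0$, $v(R)\le0$, and $u,v$ bounded in $[R,\infty)$ with $\int_R^\infty(u')^2r\,dr<\infty$ and $\int_R^\infty(v')^2r\,dr<\infty$, then $u\le0$ and $v\le0$ in $[R,\infty)$. (B) Assume $\mathbb{A}>0$, $\mathbb{D}>0$, $\mathbb{B}\ge0$, $\mathbb{C}\ge0$ and $4\mathbb{A}\mathbb{D}-(\mathbb{B}+\mathbb{C})^2>0$ in $[R,\infty)$. If $u,v$ are radial functions satisfying $$-\Delta_ru+\frac{m^2}{r^2}u+\mathbb{A}u+\mathbb{B}v\le0,\qquad -\Delta_rv+\frac{n^2}{r^2}v+\mathbb{C}u+\mathbb{D}v\ge0\qquad\text{in }[R,\infty),$$ with $u(R)\le0\le v(R)$, and $u,v$ bounded in $[R,\infty)$ with $\int_R^\infty(u')^2r\,dr<\infty$ and $\int_R^\infty(v')^2r\,dr<\infty$, then $u\le0\le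 v$ in $[R,\infty)$.
   Context: For a function $f=f(r)$, $\Delta_rf:=\frac1r(rf'(r))'$ denotes the Laplacian in $\mathbb{R}^2$ acting on radial functions. The functions $u=u(r)$, $v=v(r)$ are real-valued and twice continuously differentiable on $[R,\infty)$, the differential inequalities being understood pointwise. *)

theory Defs
  imports "HOL-Analysis.Analysis"
begin

text \<open>Derivatives are taken within the set \<open>S\<close>, hence one-sided at the left endpoint when
  \<open>S = {R..}\<close>. They are unique at non-isolated points, so the choice operator underlying
  \<^const>\<open>vector_derivative\<close> is harmless under the differentiability assumptions below.\<close>

definition deriv_on :: "real set \<Rightarrow> (real \<Rightarrow> real) \<Rightarrow> real \<Rightarrow> real" where
  "deriv_on S f r = vector_derivative f (at r within S)"

definition C2_on :: "real set \<Rightarrow> (real \<Rightarrow> real) \<Rightarrow> bool" where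
  "C2_on S f \<longleftrightarrow>
     f differentiable_on S \<and>
     deriv_on S f differentiable_on S \<and>
     continuous_on S (deriv_on S (deriv_on S f))"

definition radial_laplacian :: "real set \<Rightarrow> (real \<Rightarrow> real) \<Rightarrow> real \<Rightarrow> real" where
  "radial_laplacian S f r = 1 / r * deriv_on S (\<lambda>s. s * deriv_on S f s) r"

text \<open>The integral of \<open>(f')\<^sup>2 r dr\<close> is a nonnegative Lebesgue integral; it is only used with
  \<open>S \<subseteq> {0<..}\<close>, where \<^const>\<open>ennreal\<close> truncates nothing.\<close>

definition finite_radial_energy :: "real set \<Rightarrow> (real \<Rightarrow> real) \<Rightarrow> bool" where
  "finite_radial_energy S f \<longleftrightarrow>
     (\<integral>\<^sup>+ r\<in>S. ennreal ((deriv_on S f r)\<^sup>2 * r) \<partial>lborel) < \<infinity>"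

end

theory Submission
  imports Defs
begin

text \<open>
  Let \<open>G = (u\<^sup>+)\<^sup>2 + (v\<^sup>+)\<^sup>2\<close>. The sign conditions on the coupling turn the two inequalities into
  \<open>u\<^sup>+ \<Delta>u + v\<^sup>+ \<Delta>v \<ge> A (u\<^sup>+)\<^sup>2 + (B + C) u\<^sup>+ v\<^sup>+ + D (v\<^sup>+)\<^sup>2 \<ge> 0\<close>, so that
  \<open>r G'/2 = r u' u\<^sup>+ + r v' v\<^sup>+\<close> is nondecreasing. If it were positive somewhere, \<open>G\<close> would grow at
  least logarithmically, contradicting boundedness; hence \<open>G\<close> is nonincreasing, and \<open>G(R) = 0\<close>
  forces \<open>G = 0\<close>. As \<open>u\<^sup>+\<close> has corners, all monotonicity arguments use right derivatives.
  Part (B) is part (A) applied to \<open>(u, -v)\<close>.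
\<close>

text \<open>Positive parts have corners, so the two-sided mean value theorem does not apply to them.
  Adding \<open>e * x\<close> with \<open>e > 0\<close> makes every right derivative strictly
  positive. A tilted function ending below its initial value would have a last point at or above
  that value, yet it still increases to the right of that point. Letting \<open>e\<close> tend to 0
  removes the tilt.\<close>

lemma right_deriv_nonneg_imp_le:
  fixes f :: "real \<Rightarrow> real"
  assumes "a \<le> b" and cont: "continuous_on {a..b} f"
    and der: "\<And>x. a \<le> x \<Longrightarrow> x < b \<Longrightarrow> \<exists>d\<ge>0. (f has_real_derivative d) (at x within {x..})"
  shows "f a \<le> f b"
proof -
  have "f a - f b \<le> e * (b - a)" if "e > 0" for e
  proof (rule ccontr)
    assume neg: "\<not> f a - f b \<le> e * (b - a)"
    define g where "g x = f x + e * x" for x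
    \<comment> \<open>\<open>K\<close> collects the points where \<open>g\<close> has not fallen
      below \<open>g a\<close>. It is compact and contains \<open>a\<close>, so it has a largest
      element \<open>c\<close>; since \<open>g b < g a\<close>, this \<open>c\<close> lies strictly
      before \<open>b\<close>.\<close>
    define K where "K = {a..b} \<inter> g -` {g a..}"
    have "continuous_on {a..b} g"
      unfolding g_def by (intro continuous_intros cont)
    then have "closed K"
      unfolding K_def by (intro continuous_closed_preimage) auto
    moreover have "bounded K"
      by (rule bounded_subset[of "{a..b}"]) (auto simp: K_def)
    moreover have "K \<noteq> {}"
      using \<open>a \<le> b\<close> by (auto simp: K_def)
    ultimately obtain c where c: "c \<in> K" "\<And>y. y \<in> K \<Longrightarrow> y \<le> c"
      using compact_attains_sup[of K] compact_eq_bounded_closed by blast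
    have "g b < g a"
      using neg by (simp add: g_def algebra_simps)
    then have ac: "a \<le> c" "c < b" "g a \<le> g c"
      using c(1) by (auto simp: K_def less_le)
    obtain d where d: "d \<ge> 0" "(f has_real_derivative d) (at c within {c..})"
      using der ac by blast
    have "(g has_real_derivative d + e) (at c within {c..})"
      unfolding g_def by (auto intro!: derivative_eq_intros d(2))
    from has_real_derivative_pos_inc_right[OF this] obtain \<delta> where \<delta>: "\<delta> > 0"
      "\<And>h. h > 0 \<Longrightarrow> c + h \<in> {c..} \<Longrightarrow> h < \<delta> \<Longrightarrow> g c < g (c + h)"
      using d(1) \<open>e > 0\<close> by (metis add_nonneg_pos)
    \<comment> \<open>Halving \<open>\<delta>\<close> keeps the step strictly inside the range of
      increase, and the cap \<open>b - c\<close> keeps \<open>c + h\<close> in the interval, so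
      \<open>c + h\<close> is an element of \<open>K\<close> beyond its maximum.\<close>
    define h where "h = min (\<delta> / 2) (b - c)"
    have h: "h > 0" "h < \<delta>" "c + h \<le> b"
      using \<delta>(1) ac by (auto simp: h_def min_def field_simps)
    then have "g c < g (c + h)"
      using \<delta>(2) by auto
    then have "c + h \<in> K"
      using ac h by (auto simp: K_def)
    with c(2) h(1) show False by fastforce
  qed
  note small = this
  have "f a - f b \<le> 0"
  proof (rule field_le_epsilon)
    fix e :: real assume "e > 0"
    show "f a - f b \<le> 0 + e"
    proof (cases "a = b")
      case False
      then show ?thesis
        using small[of "e / (b - a)"] \<open>e > 0\<close> \<open>a \<le> b\<close> by auto
    qed (use \<open>e > 0\<close> in simp)
  qed
  then show ?thesis by simp
qed

text \<open>Where \<open>u x\<close> is nonzero, the positive part agrees nearby with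
  \<open>u\<close> or with 0; at a zero of \<open>u\<close> its right derivative is
  \<open>max 0 d\<close>. The two properties of \<open>e\<close> serve different purposes:
  \<open>e * d \<ge> 0\<close> gives the sign of the gradient term, and the last equation lets
  \<open>d\<close> replace \<open>e\<close> when the square of the positive part is
  differentiated.\<close>

lemma pos_part_has_right_derivative:
  fixes u :: "real \<Rightarrow> real"
  assumes u: "(u has_real_derivative d) (at x within {x..})"
  obtains e where "((\<lambda>y. max 0 (u y)) has_real_derivative e) (at x within {x..})"
    and "e * d \<ge> 0" and "max 0 (u x) * e = max 0 (u x) * d"
proof -
  have lim: "(u \<longlongrightarrow> u x) (at x within {x..})"
    using DERIV_continuous[OF u] by (simp add: continuous_within)
  consider "u x > 0" | "u x < 0" | "u x = 0" by linarith
  then show ?thesis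
  proof cases
    case 1
    have "\<forall>\<^sub>F y in at x within {x..}. max 0 (u y) = u y"
      using order_tendstoD(1)[OF lim 1] by eventually_elim simp
    then have "((\<lambda>y. max 0 (u y)) has_real_derivative d) (at x within {x..})"
      using has_field_derivative_cong_eventually[of "\<lambda>y. max 0 (u y)" u x "{x..}" d] u 1
      by simp
    then show ?thesis using that[of d] by simp
  next
    case 2
    have "\<forall>\<^sub>F y in at x within {x..}. max 0 (u y) = 0"
      using order_tendstoD(2)[OF lim 2] by eventually_elim simp
    then have "((\<lambda>y. max 0 (u y)) has_real_derivative 0) (at x within {x..})"
      using has_field_derivative_cong_eventually[of "\<lambda>y. max 0 (u y)" "\<lambda>_. 0" x "{x..}" 0] 2
      by simp
    then show ?thesis using that[of 0] 2 by simp
  next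
    case 3
    have "((\<lambda>y. max 0 ((u y - u x) / (y - x))) \<longlongrightarrow> max 0 d) (at x within {x..})"
      using u unfolding has_field_derivative_iff by (intro tendsto_max tendsto_const)
    \<comment> \<open>Here \<open>u x = 0\<close>, and \<open>y - x > 0\<close> to the right of
      \<open>x\<close>, so taking the positive part commutes with forming the difference
      quotient.\<close>
    moreover have "\<forall>\<^sub>F y in at x within {x..}.
        max 0 ((u y - u x) / (y - x)) = (max 0 (u y) - max 0 (u x)) / (y - x)"
      unfolding eventually_at_filter using 3
      by (intro always_eventually) (auto simp: max_def field_simps)
    ultimately have "((\<lambda>y. max 0 (u y)) has_real_derivative max 0 d) (at x within {x..})"
      unfolding has_field_derivative_iff by (rule Lim_transform_eventually)
    then show ?thesis using that[of "max 0 d"] 3 by (simp add: max_def)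
  qed
qed

text \<open>Multiply by \<open>4 * a\<close> and complete the square.\<close>

lemma quadratic_form_nonneg:
  fixes a b d x y :: real
  assumes "a > 0" and "4 * a * d - b\<^sup>2 \<ge> 0"
  shows "a * x\<^sup>2 + b * (x * y) + d * y\<^sup>2 \<ge> 0"
proof -
  have "4 * a * (a * x\<^sup>2 + b * (x * y) + d * y\<^sup>2) = (2 * a * x + b * y)\<^sup>2 + (4 * a * d - b\<^sup>2) * y\<^sup>2"
    by (simp add: power2_eq_square algebra_simps)
  also have "\<dots> \<ge> 0"
    using assms by (intro add_nonneg_nonneg mult_nonneg_nonneg) auto
  finally show ?thesis
    using assms by (simp add: zero_le_mult_iff)
qed

lemma pos_part_times_inequality:
  fixes u v \<mu> a b l :: real
  assumes "- l + \<mu> * u + a * u + b * v \<le> 0" and "\<mu> \<ge> 0" and "b \<le> 0"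
  shows "max 0 u * l \<ge> a * (max 0 u)\<^sup>2 + b * (max 0 u * max 0 v)"
proof (cases "u > 0")
  case True
  have "b * max 0 v \<le> b * v"
    using \<open>b \<le> 0\<close> by (intro mult_left_mono_neg) auto
  moreover have "\<mu> * u \<ge> 0"
    using True \<open>\<mu> \<ge> 0\<close> by simp
  ultimately have "a * u + b * max 0 v \<le> l"
    using assms(1) by linarith
  then have "u * (a * u + b * max 0 v) \<le> u * l"
    using True by simp
  then show ?thesis
    using True by (simp add: power2_eq_square algebra_simps)
qed simp

text \<open>The derivatives enter as explicit functions, with \<open>1 / r * p r\<close> and
  \<open>1 / r * q r\<close> as the radial Laplacians. Passing from \<open>v\<close> to
  \<open>- v\<close> then only flips the signs of \<open>v'\<close> and \<open>q\<close>, and no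
  derivative of a negated function has to be evaluated.\<close>

lemma radial_system_max_principle:
  fixes R m n :: real and A B C D u v u' v' p q :: "real \<Rightarrow> real"
  assumes R: "R > 0"
    and coeff: "\<And>r. r \<ge> R \<Longrightarrow> A r > 0 \<and> B r \<le> 0 \<and> C r \<le> 0 \<and> 4 * A r * D r - (B r + C r)\<^sup>2 \<ge> 0"
    and u: "\<And>r. r \<ge> R \<Longrightarrow> (u has_real_derivative u' r) (at r within {R..})"
    and v: "\<And>r. r \<ge> R \<Longrightarrow> (v has_real_derivative v' r) (at r within {R..})"
    and p: "\<And>r. r \<ge> R \<Longrightarrow> ((\<lambda>s. s * u' s) has_real_derivative p r) (at r within {R..})"
    and q: "\<And>r. r \<ge> R \<Longrightarrow> ((\<lambda>s. s * v' s) has_real_derivative q r) (at r within {R..})"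
    and ineq_u: "\<And>r. r \<ge> R \<Longrightarrow> - (1 / r * p r) + m\<^sup>2 / r\<^sup>2 * u r + A r * u r + B r * v r \<le> 0"
    and ineq_v: "\<And>r. r \<ge> R \<Longrightarrow> - (1 / r * q r) + n\<^sup>2 / r\<^sup>2 * v r + C r * u r + D r * v r \<le> 0"
    and init: "u R \<le> 0" "v R \<le> 0"
    and bdd: "bounded (u ` {R..})" "bounded (v ` {R..})"
    and r: "r \<ge> R"
  shows "u r \<le> 0 \<and> v r \<le> 0"
proof -
  \<comment> \<open>\<open>F\<close> is \<open>s / 2\<close> times the right derivative of
    \<open>G\<close>. Writing it with \<open>u'\<close> and \<open>v'\<close> makes it visibly
    continuous, and keeping \<open>s * u' s\<close> together leaves a factor whose derivative is
    \<open>p\<close>.\<close>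
  define F where "F s = max 0 (u s) * (s * u' s) + max 0 (v s) * (s * v' s)" for s
  define G where "G s = (max 0 (u s))\<^sup>2 + (max 0 (v s))\<^sup>2" for s
  have cont_uv: "continuous_on {R..} u" "continuous_on {R..} v"
    "continuous_on {R..} (\<lambda>s. s * u' s)" "continuous_on {R..} (\<lambda>s. s * v' s)"
    using u v p q by (auto intro!: DERIV_continuous_on)
  have cont_F: "continuous_on {R..} F" and cont_G: "continuous_on {R..} G"
    unfolding F_def G_def by (intro continuous_intros cont_uv)+
  have right: "(f has_real_derivative d) (at x within {x..})"
    if "(f has_real_derivative d) (at x within {R..})" "x \<ge> R" for f d x
    using that by (auto intro: DERIV_subset)
  have F_der: "\<exists>d\<ge>0. (F has_real_derivative d) (at x within {x..})"
    and G_der: "(G has_real_derivative 2 * F x / x) (at x within {x..})" if xR: "x \<ge> R" for x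
  proof -
    have x: "x > 0" using R xR by simp
    obtain e where e: "((\<lambda>y. max 0 (u y)) has_real_derivative e) (at x within {x..})"
      "e * u' x \<ge> 0" "max 0 (u x) * e = max 0 (u x) * u' x"
      by (rule pos_part_has_right_derivative[OF right[OF u[OF xR] xR]])
    obtain e' where e': "((\<lambda>y. max 0 (v y)) has_real_derivative e') (at x within {x..})"
      "e' * v' x \<ge> 0" "max 0 (v x) * e' = max 0 (v x) * v' x"
      by (rule pos_part_has_right_derivative[OF right[OF v[OF xR] xR]])
    have "(F has_real_derivative (e * (x * u' x) + max 0 (u x) * p x)
        + (e' * (x * v' x) + max 0 (v x) * q x)) (at x within {x..})"
      unfolding F_def
      using DERIV_add[OF DERIV_mult[OF e(1) right[OF p[OF xR] xR]] DERIV_mult[OF e'(1) right[OF q[OF xR] xR]]]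
      by (simp add: algebra_simps)
    \<comment> \<open>These are the gradient terms from the product rule: \<open>x > 0\<close>, and
      each one-sided derivative has a nonnegative product with \<open>u' x\<close> or
      \<open>v' x\<close>.\<close>
    moreover have "e * (x * u' x) \<ge> 0" "e' * (x * v' x) \<ge> 0"
      using e(2) e'(2) x by (metis mult.left_commute mult_nonneg_nonneg less_imp_le)+
    moreover have "max 0 (u x) * p x + max 0 (v x) * q x \<ge> 0"
    proof -
      have "A x * (max 0 (u x))\<^sup>2 + B x * (max 0 (u x) * max 0 (v x)) \<le> max 0 (u x) * (1 / x * p x)"
        using ineq_u[OF xR] coeff[OF xR] by (intro pos_part_times_inequality[of _ "m\<^sup>2 / x\<^sup>2"]) auto
      moreover have "D x * (max 0 (v x))\<^sup>2 + C x * (max 0 (v x) * max 0 (u x)) \<le> max 0 (v x) * (1 / x * q x)"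
        using ineq_v[OF xR] coeff[OF xR] by (intro pos_part_times_inequality[of _ "n\<^sup>2 / x\<^sup>2"]) auto
      \<comment> \<open>Adding the two tested inequalities produces exactly this form with middle
        coefficient \<open>B x + C x\<close>, so the discriminant hypothesis applies.\<close>
      moreover have "A x * (max 0 (u x))\<^sup>2 + (B x + C x) * (max 0 (u x) * max 0 (v x)) + D x * (max 0 (v x))\<^sup>2 \<ge> 0"
        using coeff[OF xR] by (intro quadratic_form_nonneg) auto
      ultimately have "max 0 (u x) * (1 / x * p x) + max 0 (v x) * (1 / x * q x) \<ge> 0"
        by (simp add: algebra_simps)
      then have "(max 0 (u x) * p x + max 0 (v x) * q x) / x \<ge> 0"
        by (simp add: add_divide_distrib)
      then show ?thesis
        using x by (simp add: zero_le_divide_iff)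
    qed
    ultimately show "\<exists>d\<ge>0. (F has_real_derivative d) (at x within {x..})"
      by (intro exI conjI[rotated]) (assumption | linarith)+
    have "(G has_real_derivative 2 * (max 0 (u x) * e) + 2 * (max 0 (v x) * e')) (at x within {x..})"
      unfolding G_def by (auto intro!: derivative_eq_intros e(1) e'(1))
    also have "2 * (max 0 (u x) * e) + 2 * (max 0 (v x) * e') = 2 * F x / x"
      unfolding e(3) e'(3) F_def using x by (simp add: field_simps)
    finally show "(G has_real_derivative 2 * F x / x) (at x within {x..})" .
  qed
  have F_mono: "F a \<le> F b" if "R \<le> a" "a \<le> b" for a b
  proof (rule right_deriv_nonneg_imp_le[OF \<open>a \<le> b\<close>])
    show "continuous_on {a..b} F"
      using \<open>R \<le> a\<close> by (auto intro: continuous_on_subset[OF cont_F])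
  qed (use F_der \<open>R \<le> a\<close> in simp)
  obtain K where K: "\<And>s. s \<ge> R \<Longrightarrow> G s \<le> K"
  proof -
    obtain K1 K2 where K12: "\<And>s. s \<ge> R \<Longrightarrow> \<bar>u s\<bar> \<le> K1" "\<And>s. s \<ge> R \<Longrightarrow> \<bar>v s\<bar> \<le> K2"
      using bdd by (fastforce simp: bounded_iff)
    have "G s \<le> K1\<^sup>2 + K2\<^sup>2" if "s \<ge> R" for s
      unfolding G_def using K12[OF that] by (intro add_mono power_mono) auto
    then show ?thesis using that by blast
  qed
  have F_nonpos: "F a \<le> 0" if a: "a \<ge> R" for a
  proof (rule ccontr)
    assume "\<not> F a \<le> 0"
    define c where "c = F a"
    have c: "c > 0" using \<open>\<not> F a \<le> 0\<close> by (simp add: c_def)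
    have a0: "a > 0" using R a by simp
    \<comment> \<open>The factor is chosen so that \<open>2 * c * ln s\<close> grows by exactly
      \<open>K + 1 - G a\<close> between \<open>a\<close> and \<open>b\<close>, which forces
      \<open>G b\<close> above the bound \<open>K\<close>.\<close>
    define b where "b = a * exp ((K + 1 - G a) / (2 * c))"
    have "(K + 1 - G a) / (2 * c) \<ge> 0"
      using K[OF a] c by simp
    then have "a \<le> b"
      using a0 by (simp add: b_def)
    \<comment> \<open>Since \<open>F\<close> stays at least \<open>c\<close> beyond
      \<open>a\<close>, the right derivative \<open>2 * F x / x\<close> of \<open>G\<close>
      dominates \<open>2 * c / x\<close>, that of \<open>2 * c * ln x\<close>.\<close>
    have "G a - 2 * c * ln a \<le> G b - 2 * c * ln b"
    proof (rule right_deriv_nonneg_imp_le[OF \<open>a \<le> b\<close>])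
      show "continuous_on {a..b} (\<lambda>s. G s - 2 * c * ln s)"
        using a0 a by (auto intro!: continuous_intros intro: continuous_on_subset[OF cont_G])
    next
      fix x assume x: "a \<le> x" "x < b"
      have "((\<lambda>s. G s - 2 * c * ln s) has_real_derivative 2 * F x / x - 2 * c / x) (at x within {x..})"
        using x a a0 by (auto intro!: derivative_eq_intros G_der[of x])
      moreover have "2 * F x / x - 2 * c / x \<ge> 0"
        using F_mono[OF a x(1)] a0 x by (simp add: c_def divide_right_mono)
      ultimately show "\<exists>d\<ge>0. ((\<lambda>s. G s - 2 * c * ln s) has_real_derivative d) (at x within {x..})"
        by blast
    qed
    moreover have "2 * c * ln b = 2 * c * ln a + (K + 1 - G a)"
      using a0 c by (simp add: b_def ln_mult field_simps)
    ultimately have "K + 1 \<le> G b" by linarith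
    then show False
      using K[of b] a \<open>a \<le> b\<close> by simp
  qed
  have "- G R \<le> - G r"
  proof (rule right_deriv_nonneg_imp_le[OF r])
    show "continuous_on {R..r} (\<lambda>s. - G s)"
      by (auto intro!: continuous_on_minus intro: continuous_on_subset[OF cont_G])
  next
    fix x assume x: "R \<le> x" "x < r"
    have "((\<lambda>s. - G s) has_real_derivative - (2 * F x / x)) (at x within {x..})"
      using x by (intro DERIV_minus G_der)
    moreover have "- (2 * F x / x) \<ge> 0"
      using F_nonpos[OF x(1)] R x by (simp add: divide_nonpos_pos)
    ultimately show "\<exists>d\<ge>0. ((\<lambda>s. - G s) has_real_derivative d) (at x within {x..})"
      by blast
  qed
  then have "G r \<le> 0"
    using init by (simp add: G_def)
  then have "max 0 (u r) = 0 \<and> max 0 (v r) = 0"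
    unfolding G_def by (metis sum_power2_le_zero_iff)
  then show ?thesis by linarith
qed

lemma has_real_derivative_deriv_on:
  assumes "f differentiable_on S" and "x \<in> S"
  shows "(f has_real_derivative deriv_on S f x) (at x within S)"
  using assms unfolding deriv_on_def differentiable_on_def
  by (simp add: has_real_derivative_iff_has_vector_derivative vector_derivative_works)

lemma C2_on_derivatives:
  assumes "C2_on S f" and "x \<in> S"
  shows "(f has_real_derivative deriv_on S f x) (at x within S)"
    and "((\<lambda>s. s * deriv_on S f s) has_real_derivative deriv_on S (\<lambda>s. s * deriv_on S f s) x) (at x within S)"
  using assms unfolding C2_on_def
  by (auto intro!: has_real_derivative_deriv_on differentiable_on_mult)

theorem lemma3p1:
  fixes R m n :: real and A B C D :: "real \<Rightarrow> real"
  assumes "R > 0"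
    and "bounded (A ` {R..})" and "bounded (B ` {R..})"
    and "bounded (C ` {R..})" and "bounded (D ` {R..})"
  shows
    "((\<forall>r\<ge>R. A r > 0 \<and> D r > 0 \<and> B r \<le> 0 \<and> C r \<le> 0 \<and> 4 * A r * D r - (B r + C r)\<^sup>2 > 0) \<longrightarrow>
      (\<forall>u v :: real \<Rightarrow> real.
         C2_on {R..} u \<and> C2_on {R..} v \<and>
         (\<forall>r\<ge>R. - radial_laplacian {R..} u r + m\<^sup>2 / r\<^sup>2 * u r + A r * u r + B r * v r \<le> 0) \<and>
         (\<forall>r\<ge>R. - radial_laplacian {R..} v r + n\<^sup>2 / r\<^sup>2 * v r + C r * u r + D r * v r \<le> 0) \<and>
         u R \<le> 0 \<and> v R \<le> 0 \<and>
         bounded (u ` {R..}) \<and> bounded (v ` {R..}) \<and>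
         finite_radial_energy {R..} u \<and> finite_radial_energy {R..} v \<longrightarrow>
         (\<forall>r\<ge>R. u r \<le> 0 \<and> v r \<le> 0)))
     \<and>
     ((\<forall>r\<ge>R. A r > 0 \<and> D r > 0 \<and> B r \<ge> 0 \<and> C r \<ge> 0 \<and> 4 * A r * D r - (B r + C r)\<^sup>2 > 0) \<longrightarrow>
      (\<forall>u v :: real \<Rightarrow> real.
         C2_on {R..} u \<and> C2_on {R..} v \<and>
         (\<forall>r\<ge>R. - radial_laplacian {R..} u r + m\<^sup>2 / r\<^sup>2 * u r + A r * u r + B r * v r \<le> 0) \<and>
         (\<forall>r\<ge>R. - radial_laplacian {R..} v r + n\<^sup>2 / r\<^sup>2 * v r + C r * u r + D r * v r \<ge> 0) \<and>
         u R \<le> 0 \<and> 0 \<le> v R \<and>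
         bounded (u ` {R..}) \<and> bounded (v ` {R..}) \<and>
         finite_radial_energy {R..} u \<and> finite_radial_energy {R..} v \<longrightarrow>
         (\<forall>r\<ge>R. u r \<le> 0 \<and> 0 \<le> v r)))"
proof (intro conjI impI allI)
  fix u v r
  assume coeff: "\<forall>r\<ge>R. A r > 0 \<and> D r > 0 \<and> B r \<le> 0 \<and> C r \<le> 0 \<and> 4 * A r * D r - (B r + C r)\<^sup>2 > 0"
    and uv: "C2_on {R..} u \<and> C2_on {R..} v \<and>
         (\<forall>r\<ge>R. - radial_laplacian {R..} u r + m\<^sup>2 / r\<^sup>2 * u r + A r * u r + B r * v r \<le> 0) \<and>
         (\<forall>r\<ge>R. - radial_laplacian {R..} v r + n\<^sup>2 / r\<^sup>2 * v r + C r * u r + D r * v r \<le> 0) \<and>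
         u R \<le> 0 \<and> v R \<le> 0 \<and>
         bounded (u ` {R..}) \<and> bounded (v ` {R..}) \<and>
         finite_radial_energy {R..} u \<and> finite_radial_energy {R..} v"
    and r: "R \<le> r"
  have "u r \<le> 0 \<and> v r \<le> 0"
  proof (rule radial_system_max_principle[OF \<open>R > 0\<close>, where u = u and v = v
        and u' = "deriv_on {R..} u" and v' = "deriv_on {R..} v"
        and p = "deriv_on {R..} (\<lambda>s. s * deriv_on {R..} u s)"
        and q = "deriv_on {R..} (\<lambda>s. s * deriv_on {R..} v s)" and m = m and n = n
        and A = A and B = B and C = C and D = D])
    fix s assume s: "s \<ge> R"
    show "A s > 0 \<and> B s \<le> 0 \<and> C s \<le> 0 \<and> 4 * A s * D s - (B s + C s)\<^sup>2 \<ge> 0"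
      using coeff s by (auto intro: less_imp_le)
  qed (use uv r in \<open>auto simp: radial_laplacian_def intro!: C2_on_derivatives\<close>)
  then show "u r \<le> 0" "v r \<le> 0" by auto
next
  fix u v r
  assume coeff: "\<forall>r\<ge>R. A r > 0 \<and> D r > 0 \<and> B r \<ge> 0 \<and> C r \<ge> 0 \<and> 4 * A r * D r - (B r + C r)\<^sup>2 > 0"
    and uv: "C2_on {R..} u \<and> C2_on {R..} v \<and>
         (\<forall>r\<ge>R. - radial_laplacian {R..} u r + m\<^sup>2 / r\<^sup>2 * u r + A r * u r + B r * v r \<le> 0) \<and>
         (\<forall>r\<ge>R. - radial_laplacian {R..} v r + n\<^sup>2 / r\<^sup>2 * v r + C r * u r + D r * v r \<ge> 0) \<and>
         u R \<le> 0 \<and> 0 \<le> v R \<and>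
         bounded (u ` {R..}) \<and> bounded (v ` {R..}) \<and>
         finite_radial_energy {R..} u \<and> finite_radial_energy {R..} v"
    and r: "R \<le> r"
  let ?u' = "deriv_on {R..} u" and ?v' = "deriv_on {R..} v"
  \<comment> \<open>Negate the second inequality and write both in terms of \<open>u\<close> and
    \<open>- v\<close>: the coupling coefficients become \<open>- B\<close> and \<open>- C\<close>,
    while \<open>A\<close>, \<open>D\<close> and the square of the coupling sum are
    unchanged.\<close>
  have "u r \<le> 0 \<and> - v r \<le> 0"
  proof (rule radial_system_max_principle[OF \<open>R > 0\<close>, where u = u and v = "\<lambda>s. - v s"
        and u' = ?u' and v' = "\<lambda>s. - ?v' s" and p = "deriv_on {R..} (\<lambda>s. s * ?u' s)"
        and q = "\<lambda>s. - deriv_on {R..} (\<lambda>s. s * ?v' s) s" and m = m and n = n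
        and A = A and B = "\<lambda>s. - B s" and C = "\<lambda>s. - C s" and D = D])
    fix s assume s: "s \<ge> R"
    have "(- B s + - C s)\<^sup>2 = (B s + C s)\<^sup>2"
      by (simp add: power2_eq_square algebra_simps)
    then show "A s > 0 \<and> - B s \<le> 0 \<and> - C s \<le> 0 \<and> 4 * A s * D s - (- B s + - C s)\<^sup>2 \<ge> 0"
      using coeff s by (auto intro: less_imp_le)
    show "((\<lambda>s. - v s) has_real_derivative - ?v' s) (at s within {R..})"
      using uv s by (auto intro!: DERIV_minus C2_on_derivatives)
    show "((\<lambda>s. s * - ?v' s) has_real_derivative - deriv_on {R..} (\<lambda>s. s * ?v' s) s) (at s within {R..})"
      using uv s DERIV_minus[OF C2_on_derivatives(2)[of "{R..}" v s]] by simp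
    have "- radial_laplacian {R..} v s + n\<^sup>2 / s\<^sup>2 * v s + C s * u s + D s * v s \<ge> 0"
      using uv s by blast
    then show "- (1 / s * - deriv_on {R..} (\<lambda>s. s * ?v' s) s) + n\<^sup>2 / s\<^sup>2 * - v s + - C s * u s + D s * - v s \<le> 0"
      unfolding radial_laplacian_def by simp
    have "- radial_laplacian {R..} u s + m\<^sup>2 / s\<^sup>2 * u s + A s * u s + B s * v s \<le> 0"
      using uv s by blast
    then show "- (1 / s * deriv_on {R..} (\<lambda>s. s * ?u' s) s) + m\<^sup>2 / s\<^sup>2 * u s + A s * u s + - B s * - v s \<le> 0"
      unfolding radial_laplacian_def by simp
  next
    show "bounded ((\<lambda>s. - v s) ` {R..})"
      using uv bounded_minus_comp[of v "{R..}"] by simp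
  qed (use uv r in \<open>auto intro!: C2_on_derivatives\<close>)
  then show "u r \<le> 0" "0 \<le> v r" by auto
qed

end
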